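(* For any positive integers $r\le d$, $$N_{d,r}(s)=\begin{cases}1, & s=1,\\ N_{d,r}(s-1)+N_{d,r}(s-d-1), & s\ge 2,\end{cases}$$ where $s$ ranges over positive integers and $N_{d,r}$ at nonpositive arguments is given by the extension described in the context.
   Context: A partition $\lambda=(\lambda_1,\dots,\lambda_k)$ is a finite nonincreasing sequence of positive integers (the empty partition is allowed). In its Young diagram (row $i$ has $\lambda_i$ left-justified cells), the hook length $h(i,j)$ of cell $(i,j)$ is $1$ plus the number of cells to its right in its row plus the number of cells below it in its column. For a positive integer $t$, $\lambda$ is $t$-core if no cell has hook length $t$; it is $(s,s+r)$-core if it is both $s$-core and $(s+r)$-core. $\lambda$ has $d$-distinct parts if $\lambda_i-\lambda_{i+1}\ge d$ for all $1\le i\le k-1$. For positive integers $d,r,s$, $N_{d,r}(s)$ is the number of $(s,s+r)$-core partitions with $d$-distinct parts. A set $S\subseteq\mathbb{Z}$ is $d$-th order twin-free if $|x-y|>d$ for all distinct $x,y\in S$. Extension: for positive integers $r\le d$ and integers $s\le 0$, $N_{d,r}(s)$ is defined as the number of subsets $\beta\subseteq\{1,2,\dots,s+r-1\}$ (empty if $s+r-1\le0$) such that (1) $x-s\in\beta$ for all $x\in\beta$ with $x\ge s$; (2) $x-(s+r)\in\beta$ for all $x\in\beta$ with $x\ge s+r$; (3) $\beta$ is $d$-th order twin-free. *)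

theory Defs
  imports Main
begin

text \<open>
  A partition is the list of its parts in nonincreasing order. Cells are indexed from \<open>0\<close>:
  the cell in row \<open>i\<close> and column \<open>j\<close> (counted from 1) is the pair \<open>(i - 1, j - 1)\<close>.
\<close>

definition is_partition :: "nat list \<Rightarrow> bool" where
  "is_partition ps \<longleftrightarrow> sorted_wrt (\<ge>) ps \<and> (\<forall>p \<in> set ps. 0 < p)"

definition young_diagram :: "nat list \<Rightarrow> (nat \<times> nat) set" where
  "young_diagram ps = {(i, j). i < length ps \<and> j < ps ! i}"

definition hook_length :: "nat list \<Rightarrow> nat \<Rightarrow> nat \<Rightarrow> nat" where
  "hook_length ps i j =
     1 + card {j'. j < j' \<and> (i, j') \<in> young_diagram ps}
       + card {i'. i < i' \<and> (i', j) \<in> young_diagram ps}"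

definition is_core :: "nat \<Rightarrow> nat list \<Rightarrow> bool" where
  "is_core t ps \<longleftrightarrow> (\<forall>(i, j) \<in> young_diagram ps. hook_length ps i j \<noteq> t)"

definition has_distinct_parts :: "nat \<Rightarrow> nat list \<Rightarrow> bool" where
  "has_distinct_parts d ps \<longleftrightarrow>
     (\<forall>i. i + 1 < length ps \<longrightarrow> int (ps ! i) - int (ps ! (i + 1)) \<ge> int d)"

definition twin_free :: "nat \<Rightarrow> int set \<Rightarrow> bool" where
  "twin_free d S \<longleftrightarrow> (\<forall>x \<in> S. \<forall>y \<in> S. x \<noteq> y \<longrightarrow> \<bar>x - y\<bar> > int d)"

definition core_partitions :: "nat \<Rightarrow> nat \<Rightarrow> nat \<Rightarrow> nat list set" where
  "core_partitions d r s =
     {ps. is_partition ps \<and> is_core s ps \<and> is_core (s + r) ps \<and> has_distinct_parts d ps}"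

definition extension_sets :: "nat \<Rightarrow> nat \<Rightarrow> int \<Rightarrow> int set set" where
  "extension_sets d r s =
     {\<beta>. \<beta> \<subseteq> {1 .. s + int r - 1} \<and>
         (\<forall>x \<in> \<beta>. x \<ge> s \<longrightarrow> x - s \<in> \<beta>) \<and>
         (\<forall>x \<in> \<beta>. x \<ge> s + int r \<longrightarrow> x - (s + int r) \<in> \<beta>) \<and>
         twin_free d \<beta>}"

text \<open>
  The branch \<open>s \<le> 0\<close> is meant only for \<open>1 \<le> r \<le> d\<close>. Under this hypothesis
  \<^const>\<open>core_partitions\<close> is finite for every positive \<open>s\<close>, so \<^const>\<open>card\<close> is a genuine count.
\<close>

definition N :: "nat \<Rightarrow> nat \<Rightarrow> int \<Rightarrow> nat" where
  "N d r s = (if 0 < s then card (core_partitions d r (nat s)) else card (extension_sets d r s))"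

end

theory Submission
  imports Defs
begin

text \<open>
  A partition is determined by the set of its first-column hook lengths. The hook lengths in the
  row of \<open>x\<close> are the differences \<open>x - y\<close> with \<open>0 \<le> y < x\<close> outside this set, so being \<open>t\<close>-core means
  that the set is closed under subtracting \<open>t\<close>, and \<open>d\<close>-distinctness means twin-freeness.
  If \<open>x \<ge> s + r\<close> were in the set, then so would be \<open>x - s\<close> and \<open>x - (s + r)\<close>, which are too close
  for \<open>r \<le> d\<close>; hence \<open>N\<close> counts the sets of the extension also for \<open>s > 0\<close>.

  Let \<open>F n\<close> be the number of twin-free subsets of \<open>{1..n}\<close>, so \<open>F n = F (n - 1) + F (n - d - 1)\<close>.
  The sets contained in \<open>{1..s - 1}\<close> are counted by \<open>F (s - 1)\<close>. Any other one contains exactly one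
  \<open>x \<ge> s\<close>; with \<open>a = x - s\<close> in \<open>{1..r - 1}\<close>, the remaining elements besides \<open>a\<close> form an arbitrary
  twin-free subset of \<open>{a + d + 1..s + a - d - 1}\<close>. Thus \<open>N s = F (s - 1) + (r - 1) * F (s - 2d - 1)\<close>
  for \<open>s > d\<close>, and the recurrence for \<open>N\<close> follows from the one for \<open>F\<close>.
\<close>

section \<open>Beta-sets of partitions\<close>

text \<open>There are \<open>length ps\<close> cells below the first cell of the row
  \<open>p\<close>, so the inserted number is the hook length of that cell.\<close>

fun beta :: "nat list \<Rightarrow> int set" where
  "beta [] = {}"
| "beta (p # ps) = insert (int p + int (length ps)) (beta ps)"

text \<open>Since \<open>0\<close> never lies in a beta-set of a partition, the boundary case
  \<open>x = t\<close> forbids \<open>t\<close> itself.\<close>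

definition sub_closed :: "int \<Rightarrow> int set \<Rightarrow> bool" where
  "sub_closed t B \<longleftrightarrow> (\<forall>x \<in> B. x \<ge> t \<longrightarrow> x - t \<in> B)"

lemma is_partition_Nil [simp]: "is_partition []"
  by (simp add: is_partition_def)

lemma is_partition_Cons:
  "is_partition (p # ps) \<longleftrightarrow> 0 < p \<and> (\<forall>q \<in> set ps. q \<le> p) \<and> is_partition ps"
  by (auto simp: is_partition_def)

lemma finite_beta [simp]: "finite (beta ps)"
  by (induction ps) auto

lemma beta_less: "\<lbrakk>is_partition ps; \<forall>q \<in> set ps. q \<le> p; x \<in> beta ps\<rbrakk> \<Longrightarrow> x < int p + int (length ps)"
  by (induction ps arbitrary: p) (fastforce simp: is_partition_Cons)+

lemma beta_pos: "\<lbrakk>is_partition ps; x \<in> beta ps\<rbrakk> \<Longrightarrow> 0 < x"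
  by (induction ps) (auto simp: is_partition_Cons)

lemma card_beta: "is_partition ps \<Longrightarrow> card (beta ps) = length ps"
proof (induction ps)
  case (Cons p ps)
  then have "int p + int (length ps) \<notin> beta ps"
    using beta_less by (fastforce simp: is_partition_Cons)
  with Cons show ?case by (simp add: is_partition_Cons)
qed simp

lemma insert_max_eq:
  fixes x y :: "'a::linorder"
  assumes "insert x A = insert y B" "\<forall>a \<in> A. a < x" "\<forall>b \<in> B. b < y"
  shows "x = y \<and> A = B"
proof -
  have "x = y" using assms by (metis insert_iff less_asym)
  moreover have "x \<notin> A" "y \<notin> B" using assms by auto
  ultimately show ?thesis using assms(1) by (metis insert_ident)
qed

lemma beta_inj: "\<lbrakk>is_partition ps; is_partition qs; beta ps = beta qs\<rbrakk> \<Longrightarrow> ps = qs"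
proof (induction ps arbitrary: qs)
  case Nil
  then show ?case by (cases qs) auto
next
  case (Cons p ps)
  then obtain q qs' where qs: "qs = q # qs'" by (cases qs) auto
  have "int p + int (length ps) = int q + int (length qs') \<and> beta ps = beta qs'"
    using Cons.prems beta_less unfolding qs
    by (intro insert_max_eq) (auto simp: is_partition_Cons)
  \<comment> \<open>The maxima only give \<open>p + length ps\<close>; the cardinality of the
    beta-set supplies the number of parts and so isolates \<open>p\<close>.\<close>
  moreover have "length (p # ps) = length (q # qs')"
    using card_beta Cons.prems unfolding qs by metis
  ultimately show ?case using Cons unfolding qs by (auto simp: is_partition_Cons)
qed

lemma beta_surj:
  assumes "finite B" "B \<subseteq> {0<..}"
  shows "\<exists>ps. is_partition ps \<and> beta ps = B"
  using assms
proof (induction B rule: finite_linorder_max_induct)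
  case empty
  show ?case by (intro exI[of _ "[]"]) simp
next
  case (insert b A)
  then obtain ps where ps: "is_partition ps" "beta ps = A" by auto
  define p where "p = nat (b - int (length ps))"
  have "int (length ps) < b \<and> (\<forall>q \<in> set ps. int q + int (length ps) \<le> b)"
  proof (cases ps)
    case Nil
    then show ?thesis using insert.prems by simp
  next
    case (Cons q qs)
    then have "int q + int (length qs) < b" using insert.hyps ps by auto
    then show ?thesis using Cons ps(1) by (fastforce simp: is_partition_Cons)
  qed
  then have "is_partition (p # ps)" "beta (p # ps) = insert b A"
    using ps by (auto simp: is_partition_Cons p_def)
  then show ?case by blast
qed

section \<open>Hook lengths and the core condition\<close>

lemma hook_length_Cons_Suc: "hook_length (p # ps) (Suc i) j = hook_length ps i j"
proof -
  have "{i'. Suc i < i' \<and> (i', j) \<in> young_diagram (p # ps)}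
      = Suc ` {i'. i < i' \<and> (i', j) \<in> young_diagram ps}" (is "?L = Suc ` ?R")
  proof (intro set_eqI iffI)
    fix k assume "k \<in> ?L"
    then show "k \<in> Suc ` ?R" by (cases k) (auto simp: young_diagram_def)
  qed (auto simp: young_diagram_def)
  then show ?thesis
    by (simp add: hook_length_def card_image young_diagram_def)
qed

definition parts_le :: "nat list \<Rightarrow> nat \<Rightarrow> nat" where
  "parts_le ps j = length (filter (\<lambda>q. q \<le> j) ps)"

text \<open>The arm is \<open>p - j - 1\<close>, and the leg omits the \<open>parts_le ps j\<close>
  lower rows that do not reach column \<open>j\<close>. The form of a difference from the new
  beta-element prepares for \<open>gaps_of_beta\<close>.\<close>

lemma hook_length_Cons_0:
  assumes "j < p"
  shows "int (hook_length (p # ps) 0 j) = int p + int (length ps) - (int j + int (parts_le ps j))"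
proof -
  have "{j'. j < j' \<and> (0, j') \<in> young_diagram (p # ps)} = {j<..<p}"
    by (auto simp: young_diagram_def)
  moreover have "{i'. 0 < i' \<and> (i', j) \<in> young_diagram (p # ps)}
      = Suc ` {i'. i' < length ps \<and> j < ps ! i'}" (is "?L = Suc ` ?R")
  proof (intro set_eqI iffI)
    fix k assume "k \<in> ?L"
    then show "k \<in> Suc ` ?R" by (cases k) (auto simp: young_diagram_def)
  qed (auto simp: young_diagram_def)
  moreover have "card ?R = length (filter (\<lambda>q. j < q) ps)"
    by (simp add: length_filter_conv_card)
  moreover have "length ps = length (filter (\<lambda>q. q \<le> j) ps) + length (filter (\<lambda>q. j < q) ps)"
    using sum_length_filter_compl[of "\<lambda>q. q \<le> j" ps] by (simp add: not_le)
  ultimately show ?thesis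
    using assms by (simp add: hook_length_def card_image parts_le_def)
qed

text \<open>For a first part \<open>q\<close>, the columns below \<open>q\<close> give the gaps of
  the other rows. The columns from \<open>q\<close> on lie beyond every row, so their values form an
  interval starting at \<open>q + length qs + 1\<close>. The one value skipped in between is the
  element that row \<open>q\<close> adds to the beta-set.\<close>

lemma gaps_of_beta:
  "\<lbrakk>is_partition ps; \<forall>q \<in> set ps. q \<le> p\<rbrakk> \<Longrightarrow>
    (\<lambda>j. int j + int (parts_le ps j)) ` {..<p} = {0..<int p + int (length ps)} - beta ps"
proof (induction ps arbitrary: p)
  case Nil
  then show ?case by (simp add: parts_le_def image_int_atLeastLessThan flip: atLeast0LessThan)
next
  case (Cons q qs)
  let ?n = "int (length qs)"
  have le: "q \<le> p" and part: "is_partition qs" "\<forall>q' \<in> set qs. q' \<le> q"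
    using Cons.prems by (auto simp: is_partition_Cons)
  have "(\<lambda>j. int j + int (parts_le (q # qs) j)) ` {..<q} = (\<lambda>j. int j + int (parts_le qs j)) ` {..<q}"
    by (auto simp: parts_le_def)
  also have "\<dots> = {0..<int q + ?n} - beta qs" using Cons.IH part by blast
  finally have low: "(\<lambda>j. int j + int (parts_le (q # qs) j)) ` {..<q} = {0..<int q + ?n} - beta qs" .
  have "parts_le (q # qs) j = Suc (length qs)" if "q \<le> j" for j
  proof -
    have "filter (\<lambda>q. q \<le> j) qs = qs" using part that by (fastforce simp: filter_id_conv)
    then show ?thesis using that by (simp add: parts_le_def)
  qed
  then have "(\<lambda>j. int j + int (parts_le (q # qs) j)) ` {q..<p} = (\<lambda>j. int j + (?n + 1)) ` {q..<p}"
    by (intro image_cong) auto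
  also have "\<dots> = (\<lambda>x. x + (?n + 1)) ` int ` {q..<p}" by (simp add: image_image)
  also have "\<dots> = {int q + ?n + 1..<int p + ?n + 1}"
    by (simp add: image_int_atLeastLessThan algebra_simps)
  finally have high: "(\<lambda>j. int j + int (parts_le (q # qs) j)) ` {q..<p} = {int q + ?n + 1..<int p + ?n + 1}" .
  have "{..<p} = {..<q} \<union> {q..<p}" using le by auto
  then have "(\<lambda>j. int j + int (parts_le (q # qs) j)) ` {..<p}
      = ({0..<int q + ?n} - beta qs) \<union> {int q + ?n + 1..<int p + ?n + 1}"
    by (simp only: image_Un low high)
  also have "\<dots> = {0..<int p + int (length (q # qs))} - beta (q # qs)"
    using beta_less[OF part] le by fastforce
  finally show ?case .
qed

lemma is_core_Cons:
  "is_core t (p # ps) \<longleftrightarrow> (\<forall>j<p. hook_length (p # ps) 0 j \<noteq> t) \<and> is_core t ps"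
proof -
  have "young_diagram (p # ps) = (\<lambda>j. (0, j)) ` {..<p} \<union> (\<lambda>(i, j). (Suc i, j)) ` young_diagram ps"
    (is "?L = ?R")
  proof (intro set_eqI iffI)
    fix c assume "c \<in> ?L"
    then show "c \<in> ?R"
      by (cases c; cases "fst c") (force simp: young_diagram_def)+
  qed (auto simp: young_diagram_def)
  then show ?thesis by (auto simp: is_core_def hook_length_Cons_Suc ball_Un)
qed

lemma sub_closed_insert_max:
  assumes "0 < t" "\<forall>a \<in> A. a < x"
  shows "sub_closed t (insert x A) \<longleftrightarrow> (t \<le> x \<longrightarrow> x - t \<in> A) \<and> sub_closed t A"
  using assms by (fastforce simp: sub_closed_def)

lemma is_core_iff_sub_closed:
  assumes "is_partition ps" "0 < t"
  shows "is_core t ps \<longleftrightarrow> sub_closed (int t) (beta ps)"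
  using assms(1)
proof (induction ps)
  case Nil
  show ?case by (simp add: is_core_def sub_closed_def young_diagram_def)
next
  case (Cons p ps)
  then have part: "is_partition ps" "\<forall>q \<in> set ps. q \<le> p" by (auto simp: is_partition_Cons)
  let ?x = "int p + int (length ps)"
  have "(\<exists>j<p. hook_length (p # ps) 0 j = t) \<longleftrightarrow>
      (\<exists>j<p. ?x - int t = int j + int (parts_le ps j))"
    using hook_length_Cons_0[of _ p ps] by (smt (verit) of_nat_eq_iff)
  also have "\<dots> \<longleftrightarrow> ?x - int t \<in> (\<lambda>j. int j + int (parts_le ps j)) ` {..<p}" by auto
  \<comment> \<open>Positivity of \<open>t\<close> keeps \<open>?x - t\<close> below the upper end
    \<open>?x\<close> of the interval of gaps.\<close>
  also have "\<dots> \<longleftrightarrow> int t \<le> ?x \<and> ?x - int t \<notin> beta ps"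
    using assms(2) by (auto simp: gaps_of_beta[OF part])
  finally have "(\<forall>j<p. hook_length (p # ps) 0 j \<noteq> t) \<longleftrightarrow> (int t \<le> ?x \<longrightarrow> ?x - int t \<in> beta ps)"
    by blast
  then show ?case
    using Cons.IH part assms(2) beta_less[OF part] by (simp add: is_core_Cons sub_closed_insert_max)
qed

section \<open>Distinct parts and twin-freeness\<close>

lemma twin_free_insert_max:
  assumes "\<forall>a \<in> A. a < x"
  shows "twin_free d (insert x A) \<longleftrightarrow> (\<forall>a \<in> A. a + int d < x) \<and> twin_free d A"
  using assms by (fastforce simp: twin_free_def)

lemma has_distinct_parts_Cons_Cons:
  "has_distinct_parts d (p # q # qs) \<longleftrightarrow> int q + int d \<le> int p \<and> has_distinct_parts d (q # qs)"
  (is "?L \<longleftrightarrow> ?R")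
proof
  assume L: ?L
  show ?R
    using L[unfolded has_distinct_parts_def, rule_format, of 0]
      L[unfolded has_distinct_parts_def, rule_format, of "Suc _"]
    by (auto simp: has_distinct_parts_def)
next
  assume ?R
  then show ?L
    unfolding has_distinct_parts_def by (auto simp: nth_Cons split: nat.splits)
qed

text \<open>Adjacent rows \<open>p\<close>, \<open>q\<close> have beta-elements differing by
  \<open>p - q + 1\<close>, which turns \<open>>= d\<close> into \<open>> d\<close>. The element of
  \<open>q\<close> is the largest remaining one, so adjacent rows suffice.\<close>

lemma has_distinct_parts_iff_twin_free:
  "is_partition ps \<Longrightarrow> has_distinct_parts d ps \<longleftrightarrow> twin_free d (beta ps)"
proof (induction ps)
  case Nil
  show ?case by (simp add: has_distinct_parts_def twin_free_def)
next
  case (Cons p ps)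
  then have part: "is_partition ps" "\<forall>q \<in> set ps. q \<le> p" by (auto simp: is_partition_Cons)
  show ?case
  proof (cases ps)
    case Nil
    then show ?thesis by (simp add: has_distinct_parts_def twin_free_def)
  next
    case ps: (Cons q qs)
    have less: "\<forall>a \<in> beta qs. a < int q + int (length qs)"
      using part beta_less unfolding ps by (auto simp: is_partition_Cons)
    have "twin_free d (beta (p # ps)) \<longleftrightarrow>
        (\<forall>a \<in> beta ps. a + int d < int p + int (length ps)) \<and> twin_free d (beta ps)"
      using beta_less[OF part] by (simp add: twin_free_insert_max)
    moreover have "(\<forall>a \<in> beta ps. a + int d < int p + int (length ps)) \<longleftrightarrow> int q + int d \<le> int p"
      using less unfolding ps by fastforce
    ultimately show ?thesis
      using Cons.IH part unfolding ps by (simp only: has_distinct_parts_Cons_Cons)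
  qed
qed

section \<open>From core partitions to extension sets\<close>

lemma twin_freeD: "\<lbrakk>twin_free d S; x \<in> S; y \<in> S; x < y\<rbrakk> \<Longrightarrow> x + int d < y"
  unfolding twin_free_def by fastforce

text \<open>For positive \<open>s\<close> the explicit upper bound follows from the closure
  conditions and twin-freeness; finiteness replaces it, as beta-sets require.\<close>

lemma extension_sets_pos:
  assumes "1 \<le> r" "r \<le> d" "0 < s"
  shows "extension_sets d r s =
    {B. B \<subseteq> {0<..} \<and> finite B \<and> sub_closed s B \<and> sub_closed (s + int r) B \<and> twin_free d B}"
    (is "?L = ?R")
proof (intro set_eqI iffI)
  fix B assume "B \<in> ?L"
  moreover from this have "finite B"
    by (auto simp: extension_sets_def intro: finite_subset)
  ultimately show "B \<in> ?R" by (auto simp: extension_sets_def sub_closed_def)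
next
  fix B assume B: "B \<in> ?R"
  have "x < s + int r" if "x \<in> B" for x
  proof (rule ccontr)
    assume "\<not> x < s + int r"
    then have "x - s \<in> B" "x - (s + int r) \<in> B"
      using B that by (auto simp: sub_closed_def)
    then show False
      using B twin_freeD[of d B "x - (s + int r)" "x - s"] assms by auto
  qed
  with B show "B \<in> ?L"
    by (fastforce simp: extension_sets_def sub_closed_def)
qed

lemma N_eq_card_extension_sets:
  assumes "1 \<le> r" "r \<le> d"
  shows "N d r s = card (extension_sets d r s)"
proof (cases "0 < s")
  case True
  have "bij_betw beta (core_partitions d r (nat s)) (extension_sets d r s)"
    unfolding bij_betw_def
  proof
    show "inj_on beta (core_partitions d r (nat s))"
      by (auto intro!: inj_onI beta_inj simp: core_partitions_def)
    have core: "ps \<in> core_partitions d r (nat s) \<longleftrightarrow> beta ps \<in> extension_sets d r s"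
      if "is_partition ps" for ps
      using that True assms beta_pos[OF that]
      by (auto simp: core_partitions_def extension_sets_pos is_core_iff_sub_closed
          has_distinct_parts_iff_twin_free)
    show "beta ` core_partitions d r (nat s) = extension_sets d r s"
    proof (intro set_eqI iffI)
      fix B assume B: "B \<in> extension_sets d r s"
      then obtain ps where "is_partition ps" "beta ps = B"
        using beta_surj[of B] by (auto simp: extension_sets_pos[OF assms True])
      with B core show "B \<in> beta ` core_partitions d r (nat s)" by blast
    qed (use core in \<open>auto simp: core_partitions_def\<close>)
  qed
  then show ?thesis using True by (simp add: N_def bij_betw_same_card)
qed (simp add: N_def)

section \<open>Counting twin-free sets\<close>

definition twin_free_sets :: "nat \<Rightarrow> int \<Rightarrow> int set set" where
  "twin_free_sets d n = {S. S \<subseteq> {1..n} \<and> twin_free d S}"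

lemma finite_twin_free_sets [simp]: "finite (twin_free_sets d n)"
  by (rule finite_subset[of _ "Pow {1..n}"]) (auto simp: twin_free_sets_def)

lemma twin_free_subset: "\<lbrakk>twin_free d S; T \<subseteq> S\<rbrakk> \<Longrightarrow> twin_free d T"
  by (auto simp: twin_free_def)

lemma card_twin_free_sets_nonpos: "n \<le> 0 \<Longrightarrow> card (twin_free_sets d n) = 1"
proof -
  assume "n \<le> 0"
  then have "twin_free_sets d n = {{}}" by (auto simp: twin_free_sets_def twin_free_def)
  then show ?thesis by simp
qed

text \<open>If \<open>n\<close> belongs to the set, the rest lies in \<open>{1..n - d - 1}\<close>;
  when that range is empty, the empty set still contributes 1.\<close>

lemma card_twin_free_sets_rec:
  assumes "1 \<le> n"
  shows "card (twin_free_sets d n) = card (twin_free_sets d (n - 1)) + card (twin_free_sets d (n - int d - 1))"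
proof -
  let ?A = "twin_free_sets d (n - 1)" and ?B = "twin_free_sets d (n - int d - 1)"
  have "twin_free_sets d n = ?A \<union> insert n ` ?B"
  proof (intro set_eqI iffI)
    fix S assume S: "S \<in> twin_free_sets d n"
    show "S \<in> ?A \<union> insert n ` ?B"
    proof (cases "n \<in> S")
      case True
      have "x + int d < n" if "x \<in> S - {n}" for x
        using S True that twin_freeD[of d S x n] by (fastforce simp: twin_free_sets_def)
      then have "S - {n} \<in> ?B"
        using S twin_free_subset[of d S "S - {n}"] by (fastforce simp: twin_free_sets_def)
      then show ?thesis using True by (metis UnI2 image_eqI insert_Diff)
    next
      case False
      have "x \<le> n - 1" if "x \<in> S" for x
        using S False that by (cases "x = n") (auto simp: twin_free_sets_def)
      then show ?thesis using S by (auto simp: twin_free_sets_def)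
    qed
  next
    fix S assume "S \<in> ?A \<union> insert n ` ?B"
    then show "S \<in> twin_free_sets d n"
    proof
      assume "S \<in> insert n ` ?B"
      then obtain T where T: "S = insert n T" "T \<in> ?B" by blast
      then have "twin_free d (insert n T)"
        by (subst twin_free_insert_max) (auto simp: twin_free_sets_def)
      then show ?thesis using T assms by (auto simp: twin_free_sets_def)
    qed (auto simp: twin_free_sets_def)
  qed
  moreover have "?A \<inter> insert n ` ?B = {}" by (auto simp: twin_free_sets_def)
  moreover have "inj_on (insert n) ?B"
  proof (rule inj_onI)
    fix S T assume "S \<in> ?B" "T \<in> ?B" "insert n S = insert n T"
    moreover from this have "n \<notin> S" "n \<notin> T" by (auto simp: twin_free_sets_def)
    ultimately show "S = T" by (metis insert_ident)
  qed
  ultimately show ?thesis by (simp add: card_Un_disjoint card_image)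
qed

text \<open>Rebuilds a set reaching \<open>s\<close> from \<open>a\<close> and its middle part. The
  shift moves \<open>{1..s - 2d - 1}\<close> onto \<open>{a + d + 1..a + s - d - 1}\<close>, so the
  range for \<open>C\<close> is independent of \<open>a\<close> and the count becomes a
  product.\<close>

definition wrap :: "nat \<Rightarrow> int \<Rightarrow> int \<times> int set \<Rightarrow> int set" where
  "wrap d s = (\<lambda>(a, C). insert (a + s) (insert a ((\<lambda>x. x + (a + int d)) ` C)))"

lemma twin_free_shift: "twin_free d ((\<lambda>x. x + c) ` S) \<longleftrightarrow> twin_free d S"
  by (auto simp: twin_free_def)

lemma twin_free_insert_min:
  assumes "\<forall>a \<in> A. x + int d < a" "twin_free d A"
  shows "twin_free d (insert x A)"
  using assms by (fastforce simp: twin_free_def)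

lemma extension_sets_meeting_top:
  assumes "1 \<le> r" "r \<le> d" "int d < s"
  shows "extension_sets d r s - twin_free_sets d (s - 1)
    = wrap d s ` ({1..int r - 1} \<times> twin_free_sets d (s - 2 * int d - 1))" (is "?L = wrap d s ` ?R")
proof (intro set_eqI iffI)
  fix B assume B: "B \<in> ?L"
  then have tf: "twin_free d B" and sub: "B \<subseteq> {1..s + int r - 1}"
    by (auto simp: extension_sets_def)
  obtain x where x: "x \<in> B" "s \<le> x"
    using B by (force simp: extension_sets_def twin_free_sets_def)
  define a where "a = x - s"
  have a: "a \<in> B" using B x by (auto simp: extension_sets_def a_def)
  then have a_range: "1 \<le> a" "a \<le> int r - 1" using sub x(1) by (auto simp: a_def)
  define C where "C = (\<lambda>y. y - (a + int d)) ` (B - {a, x})"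
  have C_range: "a + int d < y \<and> y + int d < x" if "y \<in> B - {a, x}" for y
  proof -
    have y: "y \<in> B" "y \<noteq> a" "y \<noteq> x" "1 \<le> y" "y \<le> s + int r - 1" using that sub by auto
    \<comment> \<open>Two elements of \<open>{1..r - 1}\<close>, or two of
      \<open>{s..s + r - 1}\<close>, are at distance less than \<open>r <= d\<close>.\<close>
    have "\<not> y < a" using twin_freeD[OF tf y(1) a] y a_range assms(2) by linarith
    moreover have "\<not> x < y" using twin_freeD[OF tf x(1) y(1)] y x(2) assms(2) by linarith
    ultimately have "a < y" "y < x" using y by auto
    then show ?thesis using twin_freeD[OF tf] a x that by auto
  qed
  have "twin_free d C"
    using tf by (auto simp: C_def twin_free_def)
  moreover have "C \<subseteq> {1..s - 2 * int d - 1}"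
    using C_range by (fastforce simp: C_def a_def)
  moreover have "B = wrap d s (a, C)"
    using a x by (auto simp: wrap_def C_def a_def image_image)
  ultimately show "B \<in> wrap d s ` ?R" using a_range by (auto simp: twin_free_sets_def)
next
  fix B assume "B \<in> wrap d s ` ?R"
  then obtain a C where B: "B = wrap d s (a, C)" and a: "1 \<le> a" "a \<le> int r - 1"
    and C: "C \<subseteq> {1..s - 2 * int d - 1}" "twin_free d C"
    by (auto simp: twin_free_sets_def)
  let ?C = "(\<lambda>x. x + (a + int d)) ` C"
  have range: "a + int d < y \<and> y + int d < a + s" if "y \<in> ?C" for y
    using that C by fastforce
  then have "twin_free d (insert a ?C)"
    using C by (intro twin_free_insert_min) (auto simp: twin_free_shift)
  then have "twin_free d B"
    unfolding B wrap_def using range assms a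
    by (simp, subst twin_free_insert_max) fastforce+
  moreover have "B \<subseteq> {1..s + int r - 1}"
    using range a assms unfolding B wrap_def by fastforce
  \<comment> \<open>Thus only \<open>a + s\<close> requires subtracting \<open>s\<close>, which
    gives \<open>a\<close>; and \<open>a + s < s + r\<close>, so no element reaches the second
    threshold.\<close>
  moreover have "y = a + s" if "y \<in> B" "s \<le> y" for y
    using that range[of y] a assms unfolding B wrap_def by fastforce
  moreover have "a \<in> B" "a + s \<in> B" by (auto simp: B wrap_def)
  ultimately show "B \<in> ?L"
    using a by (fastforce simp: extension_sets_def twin_free_sets_def)
qed

text \<open>The maximum \<open>a + s\<close> determines \<open>a\<close>; removing \<open>a\<close>
  and undoing the shift then recovers \<open>C\<close>.\<close>

lemma inj_on_wrap:
  assumes "r \<le> d" "int d < s"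
  shows "inj_on (wrap d s) ({1..int r - 1} \<times> twin_free_sets d (s - 2 * int d - 1))"
proof (rule inj_onI, clarify)
  fix a C a' C'
  assume a: "a \<in> {1..int r - 1}" "a' \<in> {1..int r - 1}"
    and C: "C \<in> twin_free_sets d (s - 2 * int d - 1)" "C' \<in> twin_free_sets d (s - 2 * int d - 1)"
    and eq: "wrap d s (a, C) = wrap d s (a', C')"
  have less: "\<forall>y \<in> insert b ((\<lambda>x. x + (b + int d)) ` D). y < b + s"
    if "D \<in> twin_free_sets d (s - 2 * int d - 1)" for b D
    using that assms by (force simp: twin_free_sets_def)
  have max: "a + s = a' + s \<and> insert a ((\<lambda>x. x + (a + int d)) ` C) = insert a' ((\<lambda>x. x + (a' + int d)) ` C')"
    using eq by (intro insert_max_eq less C) (simp add: wrap_def)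
  then have a_eq: "a' = a" by simp
  have notin: "a \<notin> (\<lambda>x. x + (a + int d)) ` D"
    if "D \<in> twin_free_sets d (s - 2 * int d - 1)" for D
    using that by (force simp: twin_free_sets_def)
  have "(\<lambda>x. x + (a + int d)) ` C = (\<lambda>x. x + (a + int d)) ` C'"
    using max insert_ident[OF notin[OF C(1)] notin[OF C(2)]] unfolding a_eq by (elim conjE) (rule iffD1)
  moreover have "inj (\<lambda>x. x + (a + int d))" by (rule injI) simp
  ultimately show "a = a' \<and> C = C'" using a_eq by (simp only: inj_image_eq_iff)
qed

section \<open>Values of \<open>N\<close> in the different ranges of \<open>s\<close>\<close>

lemma twin_free_sets_subset_extension_sets:
  "0 < s \<Longrightarrow> twin_free_sets d (s - 1) \<subseteq> extension_sets d r s"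
  by (fastforce simp: twin_free_sets_def extension_sets_def)

text \<open>An element \<open>x >= s\<close> would force \<open>x - s\<close> into the set, at
  distance \<open>s <= d\<close>.\<close>

lemma N_small:
  assumes "1 \<le> r" "r \<le> d" "1 \<le> s" "s \<le> int d"
  shows "N d r s = card (twin_free_sets d (s - 1))"
proof -
  have "extension_sets d r s \<subseteq> twin_free_sets d (s - 1)"
  proof
    fix B assume B: "B \<in> extension_sets d r s"
    then have tf: "twin_free d B" and sub: "B \<subseteq> {1..s + int r - 1}"
      by (auto simp: extension_sets_def)
    have "x \<le> s - 1" if x: "x \<in> B" for x
    proof (rule ccontr)
      assume "\<not> x \<le> s - 1"
      then have "x - s \<in> B" using B x by (auto simp: extension_sets_def)
      then show False using twin_freeD[OF tf, of "x - s" x] x assms(3,4) by linarith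
    qed
    then show "B \<in> twin_free_sets d (s - 1)" using tf sub by (auto simp: twin_free_sets_def)
  qed
  then show ?thesis
    using twin_free_sets_subset_extension_sets[of s d r] assms
    by (simp add: N_eq_card_extension_sets subset_antisym)
qed

lemma N_large:
  assumes "1 \<le> r" "r \<le> d" "int d < s"
  shows "N d r s = card (twin_free_sets d (s - 1)) + (r - 1) * card (twin_free_sets d (s - 2 * int d - 1))"
proof -
  have fin: "finite (extension_sets d r s)"
    by (rule finite_subset[of _ "Pow {1..s + int r - 1}"]) (auto simp: extension_sets_def)
  have "card (extension_sets d r s) =
      card (twin_free_sets d (s - 1)) + card (extension_sets d r s - twin_free_sets d (s - 1))"
    using twin_free_sets_subset_extension_sets[of s d r] assms fin
    by (simp add: card_Diff_subset card_mono)
  then show ?thesis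
    using assms
    by (simp add: N_eq_card_extension_sets extension_sets_meeting_top card_image inj_on_wrap
        card_cartesian_product nat_diff_distrib')
qed

text \<open>All elements lie in \<open>{1..r - 1}\<close>, where any two are too close: the empty
  set and \<open>r - 1\<close> singletons remain.\<close>

lemma N_zero:
  assumes "1 \<le> r" "r \<le> d"
  shows "N d r 0 = r"
proof -
  have "extension_sets d r 0 = insert {} ((\<lambda>x. {x}) ` {1..int r - 1})" (is "_ = ?R")
  proof (intro set_eqI iffI)
    fix B assume B: "B \<in> extension_sets d r 0"
    then have tf: "twin_free d B" by (simp add: extension_sets_def)
    have eq: "x = y" if "x \<in> B" "y \<in> B" for x y
    proof -
      have "1 \<le> x" "x \<le> int r - 1" "1 \<le> y" "y \<le> int r - 1"
        using B that by (auto simp: extension_sets_def)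
      then show ?thesis
        using twin_freeD[OF tf, of x y] twin_freeD[OF tf, of y x] that assms(2) by linarith
    qed
    show "B \<in> ?R"
    proof (cases "B = {}")
      case False
      then obtain x where "x \<in> B" by blast
      then have "B = {x}" using eq by blast
      then show ?thesis using B by (auto simp: extension_sets_def)
    qed simp
  qed (auto simp: extension_sets_def twin_free_def)
  then show ?thesis
    using assms by (simp add: N_eq_card_extension_sets card_insert_if card_image image_iff)
qed

text \<open>Every element is positive, hence at least \<open>s\<close>, so subtracting the negative
  \<open>s\<close> from the maximum would produce a larger element.\<close>

lemma N_neg:
  assumes "1 \<le> r" "r \<le> d" "s < 0"
  shows "N d r s = 1"
proof -
  have "B = {}" if B: "B \<in> extension_sets d r s" for B
  proof (rule ccontr)
    assume "B \<noteq> {}"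
    moreover have fin: "finite B"
      using B by (auto simp: extension_sets_def intro: finite_subset)
    ultimately have "Max B \<in> B" by simp
    then have "Max B - s \<in> B" using B assms by (fastforce simp: extension_sets_def)
    then show False using Max_ge[OF fin] assms by fastforce
  qed
  then have "extension_sets d r s = {{}}" by (auto simp: extension_sets_def twin_free_def)
  then show ?thesis using assms by (simp add: N_eq_card_extension_sets)
qed

theorem theorem4p1:
  fixes d r :: nat and s :: int
  assumes "1 \<le> r" and "r \<le> d" and "1 \<le> s"
  shows "N d r s = (if s = 1 then 1 else N d r (s - 1) + N d r (s - int d - 1))"
proof (cases "s = 1")
  case True
  then show ?thesis using assms by (simp add: N_small card_twin_free_sets_nonpos)
next
  case False
  then have s: "2 \<le> s" using assms by simp
  let ?F = "\<lambda>n. card (twin_free_sets d n)"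
  have F: "?F (s - 1) = ?F (s - 2) + ?F (s - int d - 2)"
    using card_twin_free_sets_rec[of "s - 1" d] s by (simp add: algebra_simps)
  \<comment> \<open>The cases follow which formula applies to \<open>s\<close>, \<open>s - 1\<close>
    and \<open>s - d - 1\<close>.\<close>
  consider "s \<le> int d" | "s = int d + 1" | "int d + 2 \<le> s" "s \<le> 2 * int d + 1" | "2 * int d + 2 \<le> s"
    by linarith
  then have "N d r s = N d r (s - 1) + N d r (s - int d - 1)"
  proof cases
    case 1
    then show ?thesis
      using F s assms by (simp add: N_small N_neg card_twin_free_sets_nonpos)
  next
    case 2
    \<comment> \<open>Sets reaching \<open>s\<close> first appear here: their number
      \<open>r - 1\<close>, plus the 1 from the recurrence for \<open>?F\<close>, matches
      \<open>N d r 0 = r\<close>.\<close>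
    then show ?thesis
      using F s assms by (simp add: N_large N_small N_zero card_twin_free_sets_nonpos)
  next
    case 3
    \<comment> \<open>The extra terms at \<open>s\<close> and \<open>s - 1\<close> both equal
      \<open>r - 1\<close>, as their \<open>?F\<close> arguments are nonpositive.\<close>
    then show ?thesis
      using F s assms by (simp add: N_large N_small card_twin_free_sets_nonpos algebra_simps)
  next
    case 4
    have "?F (s - 2 * int d - 1) = ?F (s - 2 * int d - 2) + ?F (s - 3 * int d - 2)"
      using card_twin_free_sets_rec[of "s - 2 * int d - 1" d] 4 by (simp add: algebra_simps)
    \<comment> \<open>Removes the truncated subtraction in \<open>r - 1\<close>.\<close>
    moreover obtain q where "r = Suc q" using assms(1) by (cases r) auto
    ultimately show ?thesis
      using F 4 assms by (simp add: N_large algebra_simps)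
  qed
  then show ?thesis using False by simp
qed

end
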